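(* (Sharpness of the lower bounds for the overlap of neighborhoods of great circles.) For every $s \geq 0$ and every $c>0$ there exists a constant $K = K(s,c) < \infty$ such that the following holds for every integer $n \geq 2$. If $p_1, \dots, p_n \in \mathbb{S}^2$ satisfy $$ \min_{\substack{1 \leq i,j \leq n \\ i \neq j}} \|\pm p_i \pm p_j\| \geq \frac{c}{\sqrt{n}} $$ (for all choices of signs), and $C_i$ denotes the $1/n$-neighborhood of the great circle having $p_i$ and $-p_i$ as its poles, then $$ \sum_{\substack{i,j=1 \\ i \neq j}}^{n} |C_i \cap C_j|^s \;\leq\; K \begin{cases} n^{2-2s} & \text{if } 0 \leq s < 2, \\ n^{-2} \log n & \text{if } s = 2, \\ n^{1-3s/2} & \text{if } s > 2. \end{cases}$$ Moreover, there is an absolute constant $c_0 > 0$ such that for every integer $n \geq 2$ there exist points $p_1,\dots,p_n \in \mathbb{S}^2$ satisfying the separation condition with $c = c_0$. In particular, for $s=1$ there are, for every $n$, arrangements of $n$ great circles for which the sum of mutual overlaps is bounded by a constant independent of $n$.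
   Context: $\mathbb{S}^2$ is the unit sphere in $\mathbb{R}^3$ and $\|\cdot\|$ is the Euclidean norm on $\mathbb{R}^3$. A great circle is the intersection of $\mathbb{S}^2$ with a plane through the origin; the great circle with poles $\pm p$ is $\{x \in \mathbb{S}^2 : \langle x,p\rangle = 0\}$. The $1/n$-neighborhood of a great circle is the set of points of $\mathbb{S}^2$ at geodesic distance at most $1/n$ from it. $|\cdot|$ denotes surface area on $\mathbb{S}^2$ (total area $4\pi$). The sum runs over ordered pairs $(i,j)$ with $i\neq j$. *)

theory Defs
  imports "HOL-Analysis.Analysis"
begin

abbreviation S2 :: "(real ^ 3) set" where
  "S2 \<equiv> sphere 0 1"

definition great_circle :: "real ^ 3 \<Rightarrow> (real ^ 3) set" where
  "great_circle p = {x \<in> S2. x \<bullet> p = 0}"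

text \<open>The angle between two unit vectors is their geodesic distance on the unit sphere.\<close>

definition geodesic_dist :: "real ^ 3 \<Rightarrow> real ^ 3 \<Rightarrow> real" where
  "geodesic_dist x y = arccos (x \<bullet> y)"

definition geodesic_nbhd :: "real \<Rightarrow> (real ^ 3) set \<Rightarrow> (real ^ 3) set" where
  "geodesic_nbhd r A = {x \<in> S2. (INF y\<in>A. geodesic_dist x y) \<le> r}"

text \<open>Surface area of a subset of the sphere, as the cone measure: by integration in polar
  coordinates, the solid cone over \<open>A\<close> with apex at the origin has volume
  \<open>\<integral>\<^sub>0\<^sup>1 t\<^sup>2 |A| dt = |A| / 3\<close>.\<close>

definition sphere_area :: "(real ^ 3) set \<Rightarrow> real" where
  "sphere_area A = 3 * measure lebesgue {t *\<^sub>R x | t x. 0 \<le> t \<and> t \<le> 1 \<and> x \<in> A}"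

lemma sphere_area_S2: "sphere_area S2 = 4 * pi"
proof -
  have "{t *\<^sub>R x | t x. 0 \<le> t \<and> t \<le> 1 \<and> x \<in> S2} = cball (0 :: real ^ 3) 1"
  proof (intro equalityI subsetI)
    fix y :: "real ^ 3"
    assume "y \<in> cball 0 1"
    then have y: "norm y \<le> 1" by simp
    show "y \<in> {t *\<^sub>R x | t x. 0 \<le> t \<and> t \<le> 1 \<and> x \<in> S2}"
    proof (cases "y = 0")
      case True
      obtain b :: "real ^ 3" where "b \<in> Basis" using nonempty_Basis by blast
      then have "y = 0 *\<^sub>R b \<and> b \<in> S2" using True by simp
      then show ?thesis by (intro CollectI exI[of _ 0] exI[of _ b]) auto
    next
      case False
      then have "y = norm y *\<^sub>R (y /\<^sub>R norm y) \<and> y /\<^sub>R norm y \<in> S2" by simp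
      then show ?thesis using y
        by (intro CollectI exI[of _ "norm y"] exI[of _ "y /\<^sub>R norm y"]) auto
    qed
  qed auto
  then show ?thesis
    by (simp add: sphere_area_def content_cball unit_ball_vol_3)
qed

text \<open>The minimum of \<open>\<parallel>\<plusminus>p\<^sub>i \<plusminus> p\<^sub>j\<parallel>\<close> over
  \<open>i \<noteq> j\<close> and all signs; only meaningful for \<open>n \<ge> 2\<close>, as the set is empty otherwise.\<close>

definition pole_separation :: "nat \<Rightarrow> (nat \<Rightarrow> real ^ 3) \<Rightarrow> real" where
  "pole_separation n p =
     Min {norm (a *\<^sub>R p i + b *\<^sub>R p j) | i j a b.
            i \<in> {1..n} \<and> j \<in> {1..n} \<and> i \<noteq> j \<and> a \<in> {1, -1} \<and> b \<in> {1, -1}}"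

definition overlap :: "nat \<Rightarrow> (nat \<Rightarrow> real ^ 3) \<Rightarrow> nat \<Rightarrow> nat \<Rightarrow> real" where
  "overlap n p i j =
     sphere_area (geodesic_nbhd (1 / real n) (great_circle (p i)) \<inter>
                  geodesic_nbhd (1 / real n) (great_circle (p j)))"

end

(*
  The 1/n-neighbourhood of the great circle with pole p lies in the slab |<x,p>| <= 1/n.
  A linear change of variables with determinant |p x q|^2 bounds the volume of the cone over
  the intersection of two such slabs by 8 / (n^2 |p x q|), and |p x q| is comparable to
  d = min(|p - q|, |p + q|).  By packing, at most a constant times R^2 n / c^2 poles lie at
  distance d <= R from a given one, so the k-th smallest distance is at least of order
  c (k / n)^(1/2), and everything reduces to the growth of the sum of k^(-s/2) over k <= n.
  Separated poles are obtained by lifting a square grid to the upper hemisphere.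
*)

theory Submission
  imports Defs
begin

section \<open>Area of the overlap of two neighbourhoods\<close>

text \<open>For \<open>y\<close> on the circle at geodesic distance \<open>t\<close> from
  \<open>x\<close>, the chord \<open>norm (x - y)\<close> equals \<open>2 * sin (t/2)\<close>, hence
  is at most \<open>t\<close>; and \<open>x \<bullet> p = (x - y) \<bullet> p\<close> is bounded by
  the chord.\<close>

lemma geodesic_nbhd_great_circle_subset:
  assumes p: "p \<in> S2"
  shows "geodesic_nbhd r (great_circle p) \<subseteq> {x \<in> S2. \<bar>x \<bullet> p\<bar> \<le> r}"
proof
  fix x assume "x \<in> geodesic_nbhd r (great_circle p)"
  then have x: "norm x = 1" and r: "(INF y\<in>great_circle p. geodesic_dist x y) \<le> r"
    by (auto simp: geodesic_nbhd_def)
  \<comment> \<open>This vector shows that the circle is nonempty; over an empty index set the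
    real-valued \<open>INF\<close> would carry no information.\<close>
  obtain e :: "real ^ 3" where e: "norm e = 1" "orthogonal p e"
  proof -
    obtain y where "y \<noteq> 0" "orthogonal p y"
      using orthogonal_to_vector_exists[of p] by auto
    then show thesis by (intro that[of "sgn y"]) (auto simp: norm_sgn sgn_div_norm orthogonal_def)
  qed
  then have "great_circle p \<noteq> {}"
    by (auto simp: great_circle_def orthogonal_def inner_commute)
  moreover have "\<bar>x \<bullet> p\<bar> \<le> geodesic_dist x y" if "y \<in> great_circle p" for y
  proof -
    have y: "norm y = 1" "y \<bullet> p = 0" using that by (auto simp: great_circle_def)
    define t where "t = geodesic_dist x y"
    have "\<bar>x \<bullet> y\<bar> \<le> 1" using Cauchy_Schwarz_ineq2[of x y] x y by simp
    then have t: "cos t = x \<bullet> y" "0 \<le> t"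
      by (auto simp: t_def geodesic_dist_def intro!: arccos_lbound)
    have "(norm (x - y))\<^sup>2 = 2 - 2 * cos t"
      using x y by (simp add: power2_norm_eq_inner inner_diff_left inner_diff_right t
          inner_commute norm_eq_1)
    also have "\<dots> = (2 * sin (t/2))\<^sup>2"
      using cos_double_sin[of "t/2"] by (simp add: power_mult_distrib)
    also have "\<dots> \<le> t\<^sup>2"
      using abs_sin_x_le_abs_x[of "t/2"] t(2) by (subst abs_le_square_iff[symmetric]) (simp add: abs_mult)
    finally have "norm (x - y) \<le> t"
      using t(2) by (simp add: power2_le_iff_abs_le)
    moreover have "\<bar>x \<bullet> p\<bar> \<le> norm (x - y)"
      using Cauchy_Schwarz_ineq2[of "x - y" p] y p by (simp add: inner_diff_left)
    ultimately show ?thesis by (simp add: t_def)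
  qed
  ultimately have "\<bar>x \<bullet> p\<bar> \<le> (INF y\<in>great_circle p. geodesic_dist x y)"
    by (intro cINF_greatest)
  then show "x \<in> {x \<in> S2. \<bar>x \<bullet> p\<bar> \<le> r}" using x r by simp
qed

text \<open>With \<open>w = cross3 p q\<close> and \<open>D = norm w\<close>, the map sending
  \<open>y\<close> to its inner products with \<open>p\<close>, \<open>q\<close>, \<open>w\<close>
  has determinant \<open>D^2\<close>. It sends \<open>S\<close> into a box with half-sides
  \<open>a\<close>, \<open>a\<close>, \<open>D\<close>; the last one is Cauchy-Schwarz in the unit
  ball. Dividing the box volume \<open>8 * a^2 * D\<close> by \<open>D^2\<close> gives the
  bound.\<close>

lemma measure_slab_intersection_le:
  fixes p q :: "real ^ 3"
  assumes pq: "cross3 p q \<noteq> 0" and a: "0 \<le> a"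
    and S: "S \<subseteq> cball 0 1" "\<And>y. y \<in> S \<Longrightarrow> \<bar>y \<bullet> p\<bar> \<le> a" "\<And>y. y \<in> S \<Longrightarrow> \<bar>y \<bullet> q\<bar> \<le> a"
  shows "measure lebesgue S \<le> 8 * a\<^sup>2 / norm (cross3 p q)"
proof (cases "S \<in> sets lebesgue")
  \<comment> \<open>A non-measurable set has \<open>measure\<close> 0 by convention, so the cones to
    which the lemma is applied need no measurability proof.\<close>
  case False
  then show ?thesis by (simp add: measure_notin_sets)
next
  case True
  define w where "w = cross3 p q"
  define D where "D = norm w"
  have D: "D > 0" using pq by (simp add: D_def w_def)
  define M :: "real ^ 3 ^ 3" where "M = vector [p, q, w]"
  define T where "T = (\<lambda>y. M *v y)"
  define b :: "real ^ 3" where "b = vector [a, a, D]"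
  have det: "det M = D\<^sup>2"
    unfolding M_def dot_cross_det[symmetric] w_def D_def power2_norm_eq_inner
    using cross_triple[of p q "cross3 p q"] by (simp add: inner_commute)
  have S': "S \<in> lmeasurable"
    using True S(1) bounded_cball bounded_set_imp_lmeasurable bounded_subset by blast
  have sub: "T ` S \<subseteq> cbox (- b) b"
  proof
    fix z assume "z \<in> T ` S"
    then obtain y where y: "y \<in> S" "z = T y" by auto
    have "\<bar>y \<bullet> w\<bar> \<le> norm y * D" unfolding D_def by (rule Cauchy_Schwarz_ineq2)
    also have "\<dots> \<le> 1 * D" using y S(1) D by (intro mult_right_mono) auto
    finally have "\<bar>y \<bullet> w\<bar> \<le> D" by simp
    then show "z \<in> cbox (- b) b"
      using S(2)[OF y(1)] S(3)[OF y(1)] y(2)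
      by (auto simp: mem_box_cart T_def matrix_vector_mul_component M_def b_def forall_3
          inner_commute abs_le_iff)
  qed
  have lin: "linear T" unfolding T_def by (rule matrix_vector_mul_linear)
  have "D\<^sup>2 * measure lebesgue S = measure lebesgue (T ` S)"
    using measure_linear_image[OF lin S'] det by (simp add: T_def matrix_of_matrix_vector_mul)
  also have "\<dots> \<le> measure lebesgue (cbox (- b) b)"
    using sub measurable_linear_image[OF lin S'] by (intro measure_mono_fmeasurable) auto
  also have "\<dots> = (2 * a) * (2 * a) * (2 * D)"
  proof -
    have ne: "cbox (- b) b \<noteq> {}"
      using a D by (simp add: interval_ne_empty_cart forall_3 b_def)
    have "measure lborel (cbox (- b) b) = (\<Prod>i\<in>{1, 2, 3 :: 3}. b $ i - (- b) $ i)"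
      unfolding content_cbox_cart[OF ne] UNIV_3 ..
    then show ?thesis by (simp add: b_def)
  qed
  finally have "D * (D * measure lebesgue S) \<le> D * (8 * a\<^sup>2)"
    by (simp add: power2_eq_square algebra_simps)
  then have "D * measure lebesgue S \<le> 8 * a\<^sup>2" using D by simp
  then show ?thesis using D unfolding D_def w_def by (simp add: field_simps)
qed

text \<open>Put \<open>u = p \<bullet> q\<close>. The squared minimum is
  \<open>2 * (1 - \<bar>u\<bar>)\<close>, while the squared cross product is
  \<open>(1 - \<bar>u\<bar>) * (1 + \<bar>u\<bar>)\<close>, whose second factor is at least 1. This
  replaces the sine of the angle by a chordal distance, which suits packing arguments.\<close>

lemma norm_cross3_ge_min:
  assumes "p \<in> S2" "q \<in> S2"
  shows "min (norm (p - q)) (norm (p + q)) \<le> 2 * norm (cross3 p q)"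
proof -
  define u where "u = p \<bullet> q"
  have n: "norm p = 1" "norm q = 1" using assms by auto
  have u: "\<bar>u\<bar> \<le> 1" using Cauchy_Schwarz_ineq2[of p q] n by (simp add: u_def)
  have m: "(norm (p - q))\<^sup>2 = 2 - 2 * u" "(norm (p + q))\<^sup>2 = 2 + 2 * u"
    using n by (simp_all add: power2_norm_eq_inner inner_diff_left inner_diff_right
        inner_add_left inner_add_right u_def inner_commute norm_eq_1)
  have c: "(norm (cross3 p q))\<^sup>2 = (1 - u) * (1 + u)"
    using norm_cross[of p q] n by (simp add: u_def power2_eq_square algebra_simps)
  have "(min (norm (p - q)) (norm (p + q)))\<^sup>2 \<le> 2 - 2 * \<bar>u\<bar>"
  proof (cases "0 \<le> u")
    case True
    have "(min (norm (p - q)) (norm (p + q)))\<^sup>2 \<le> (norm (p - q))\<^sup>2" by (intro power_mono) auto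
    then show ?thesis using True m by simp
  next
    case False
    have "(min (norm (p - q)) (norm (p + q)))\<^sup>2 \<le> (norm (p + q))\<^sup>2" by (intro power_mono) auto
    then show ?thesis using False m by simp
  qed
  also have "\<dots> \<le> 4 * ((1 - \<bar>u\<bar>) * (1 + \<bar>u\<bar>))"
    using u mult_left_mono[of 1 "2 * (1 + \<bar>u\<bar>)" "2 * (1 - \<bar>u\<bar>)"] by (simp add: algebra_simps)
  also have "\<dots> = 4 * ((1 - u) * (1 + u))" by (simp add: algebra_simps)
  also have "\<dots> = (2 * norm (cross3 p q))\<^sup>2" using c by (simp add: power_mult_distrib)
  finally show ?thesis by (rule power2_le_imp_le) simp
qed

lemma overlap_nonneg: "0 \<le> overlap n p i j"
  by (simp add: overlap_def sphere_area_def)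

text \<open>The constant is \<open>48 = 3 * 8 * 2\<close>: 3 normalises the cone measure, 8 comes
  from the box containing the image of the slabs, and 2 from passing from the cross product to the
  chordal distance.\<close>

lemma overlap_le:
  assumes p: "p i \<in> S2" "p j \<in> S2"
    and d: "0 < min (norm (p i - p j)) (norm (p i + p j))"
  shows "overlap n p i j \<le> 48 / (real n)\<^sup>2 * (1 / min (norm (p i - p j)) (norm (p i + p j)))"
proof -
  define a where "a = 1 / real n"
  define d where "d = min (norm (p i - p j)) (norm (p i + p j))"
  define D where "D = norm (cross3 (p i) (p j))"
  define X where "X = geodesic_nbhd a (great_circle (p i)) \<inter> geodesic_nbhd a (great_circle (p j))"
  have X: "norm x = 1 \<and> \<bar>x \<bullet> p i\<bar> \<le> a \<and> \<bar>x \<bullet> p j\<bar> \<le> a" if "x \<in> X" for x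
    using that geodesic_nbhd_great_circle_subset[OF p(1), of a]
      geodesic_nbhd_great_circle_subset[OF p(2), of a] unfolding X_def by force
  have dD: "d \<le> 2 * D" "0 < d"
    using norm_cross3_ge_min[OF p] d by (auto simp: d_def D_def)
  have "measure lebesgue {t *\<^sub>R x | t x. 0 \<le> t \<and> t \<le> 1 \<and> x \<in> X} \<le> 8 * a\<^sup>2 / D"
    unfolding D_def
  proof (rule measure_slab_intersection_le)
    show "cross3 (p i) (p j) \<noteq> 0" using dD by (auto simp: D_def)
    show "0 \<le> a" by (simp add: a_def)
    \<comment> \<open>Slabs are star-shaped about the origin, so the whole cone over the overlap
      stays inside them.\<close>
    have *: "\<bar>(t *\<^sub>R x) \<bullet> v\<bar> \<le> a" if "0 \<le> t" "t \<le> 1" "\<bar>x \<bullet> v\<bar> \<le> a" for t and x v :: "real ^ 3"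
      using that mult_left_le_one_le[of "\<bar>x \<bullet> v\<bar>" t] by (simp add: abs_mult)
    show "{t *\<^sub>R x | t x. 0 \<le> t \<and> t \<le> 1 \<and> x \<in> X} \<subseteq> cball 0 1" using X by auto
    show "\<bar>y \<bullet> p i\<bar> \<le> a" "\<bar>y \<bullet> p j\<bar> \<le> a"
      if "y \<in> {t *\<^sub>R x | t x. 0 \<le> t \<and> t \<le> 1 \<and> x \<in> X}" for y
      using that X * by blast+
  qed
  then have "overlap n p i j \<le> 24 * a\<^sup>2 * (1 / D)"
    by (simp add: overlap_def sphere_area_def X_def a_def)
  also have "\<dots> \<le> 24 * a\<^sup>2 * (2 / d)"
    using dD by (intro mult_left_mono) (auto simp: field_simps)
  finally show ?thesis by (simp add: a_def d_def power_divide)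
qed

section \<open>From counting to sums of powers\<close>

text \<open>The small balls are disjoint, so their volumes add up to at most that of the large ball;
  the unit ball volume cancels.\<close>

lemma card_ball_packing_le:
  fixes x :: "'i \<Rightarrow> 'a :: euclidean_space"
  assumes "finite I" and r: "0 < r" and R: "0 \<le> R"
    and sep: "\<And>i j. i \<in> I \<Longrightarrow> j \<in> I \<Longrightarrow> i \<noteq> j \<Longrightarrow> 2 * r \<le> dist (x i) (x j)"
    and sub: "\<And>i. i \<in> I \<Longrightarrow> ball (x i) r \<subseteq> ball c R"
  shows "real (card I) * r ^ DIM('a) \<le> R ^ DIM('a)"
proof -
  define u where "u = unit_ball_vol (real DIM('a))"
  have u: "u > 0" unfolding u_def by simp
  have disj: "disjoint_family_on (\<lambda>i. ball (x i) r) I"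
    unfolding disjoint_family_on_def
  proof (intro ballI impI)
    fix i j assume "i \<in> I" "j \<in> I" "i \<noteq> j"
    then have "2 * r \<le> dist (x i) (x j)" by (rule sep)
    then show "ball (x i) r \<inter> ball (x j) r = {}"
      by (intro disjoint_ballI) simp
  qed
  have "real (card I) * (u * r ^ DIM('a)) = (\<Sum>i\<in>I. measure lborel (ball (x i) r))"
    using r by (simp add: content_ball u_def)
  also have "\<dots> = measure lborel (\<Union>i\<in>I. ball (x i) r)"
    using \<open>finite I\<close> disj emeasure_lborel_ball_finite
    by (intro measure_finite_Union[symmetric]) (auto simp: less_top[symmetric] less_imp_neq)
  also have "\<dots> \<le> measure lborel (ball c R)"
    using sub \<open>finite I\<close> emeasure_lborel_ball_finite[of c R]
    by (intro measure_mono_fmeasurable fmeasurableI) auto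
  also have "\<dots> = u * R ^ DIM('a)" using R by (simp add: content_ball u_def)
  finally have "u * (real (card I) * r ^ DIM('a)) \<le> u * R ^ DIM('a)" by (simp add: algebra_simps)
  then show ?thesis using u by simp
qed

text \<open>List the values of \<open>g\<close> in decreasing order. At the \<open>k\<close>-th one
  at least \<open>k\<close> indices are counted, so that value is at most
  \<open>sqrt (B / k)\<close>. The induction carries this out without sorting, by removing a
  smallest value each time.\<close>

lemma sum_powr_le_of_card_le:
  fixes g :: "'i \<Rightarrow> real"
  assumes "finite J" and s: "0 \<le> s"
    and "\<And>j. j \<in> J \<Longrightarrow> 0 \<le> g j"
    and "\<And>j. j \<in> J \<Longrightarrow> real (card {i \<in> J. g j \<le> g i}) * (g j)\<^sup>2 \<le> B"
  shows "(\<Sum>j\<in>J. g j powr s) \<le> (\<Sum>k=1..card J. (B / real k) powr (s / 2))"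
  using assms(1,3,4)
proof (induction "card J" arbitrary: J)
  case 0
  then show ?case by simp
next
  case (Suc n)
  then have "J \<noteq> {}" by auto
  then obtain m where m: "m \<in> J" "\<And>i. i \<in> J \<Longrightarrow> g m \<le> g i"
    using ex_min_if_finite[of "g ` J"] \<open>finite J\<close>
    by (metis (no_types, lifting) arg_min_if_finite(1) arg_min_least)
  \<comment> \<open>The minimiser has all of \<open>J\<close> above it, so it pays for the last term
    \<open>k = card J\<close>.\<close>
  have "{i \<in> J. g m \<le> g i} = J" using m by auto
  then have "real (Suc n) * (g m)\<^sup>2 \<le> B" using Suc.prems(3)[OF m(1)] Suc.hyps(2) by simp
  then have "(g m)\<^sup>2 \<le> B / real (Suc n)" by (simp add: field_simps)
  moreover have "g m = ((g m)\<^sup>2) powr (1/2)"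
    using Suc.prems(2)[OF m(1)] by (simp add: powr_half_sqrt)
  ultimately have "g m \<le> (B / real (Suc n)) powr (1/2)"
    by (metis powr_mono2 zero_le_power2 zero_le_divide_1_iff zero_le_numeral)
  then have gm: "g m powr s \<le> (B / real (Suc n)) powr (s/2)"
    using powr_mono2[OF s Suc.prems(2)[OF m(1)]] by (fastforce simp: powr_powr)
  have IH: "(\<Sum>j\<in>J - {m}. g j powr s) \<le> (\<Sum>k=1..card (J - {m}). (B / real k) powr (s / 2))"
  proof (rule Suc.hyps(1))
    show "n = card (J - {m})" using Suc.hyps(2) m \<open>finite J\<close> by simp
    show "finite (J - {m})" using \<open>finite J\<close> by simp
    show "0 \<le> g j" if "j \<in> J - {m}" for j using that Suc.prems by auto
    show "real (card {i \<in> J - {m}. g j \<le> g i}) * (g j)\<^sup>2 \<le> B" if "j \<in> J - {m}" for j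
    proof -
      have "card {i \<in> J - {m}. g j \<le> g i} \<le> card {i \<in> J. g j \<le> g i}"
        using \<open>finite J\<close> by (intro card_mono) auto
      then have "real (card {i \<in> J - {m}. g j \<le> g i}) * (g j)\<^sup>2
          \<le> real (card {i \<in> J. g j \<le> g i}) * (g j)\<^sup>2"
        by (intro mult_right_mono) auto
      also have "\<dots> \<le> B" using Suc.prems(3) that by auto
      finally show ?thesis .
    qed
  qed
  have c: "card (J - {m}) = n" using Suc.hyps(2) m \<open>finite J\<close> by simp
  have "(\<Sum>j\<in>J. g j powr s) = g m powr s + (\<Sum>j\<in>J - {m}. g j powr s)"
    using m \<open>finite J\<close> by (simp add: sum.remove)
  also have "\<dots> \<le> (B / real (Suc n)) powr (s/2) + (\<Sum>k=1..n. (B / real k) powr (s / 2))"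
    using gm IH c by simp
  also have "\<dots> = (\<Sum>k=1..card J. (B / real k) powr (s / 2))"
    by (simp add: Suc.hyps(2)[symmetric])
  finally show ?case .
qed

text \<open>This is comparison with the integral of \<open>x powr - a\<close> from 0 to
  \<open>n\<close>: the mean value theorem bounds each term by an increment of the antiderivative,
  and the increments telescope.\<close>

lemma sum_powr_neg_le:
  assumes a: "0 \<le> a" "a < 1"
  shows "(\<Sum>k=1..n. real k powr - a) \<le> real n powr (1 - a) / (1 - a)"
proof (induction n)
  case 0
  then show ?case by simp
next
  case (Suc n)
  have "(1 - a) * real (Suc n) powr - a \<le> real (Suc n) powr (1 - a) - real n powr (1 - a)"
  \<comment> \<open>The antiderivative need not be differentiable at 0, so the first increment is
    computed directly, using \<open>0 powr (1 - a) = 0\<close>.\<close>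
  proof (cases "n = 0")
    case True
    then show ?thesis using a by simp
  next
    case False
    have "\<exists>z. real n < z \<and> z < real (Suc n) \<and>
      real (Suc n) powr (1 - a) - real n powr (1 - a)
        = (real (Suc n) - real n) * ((1 - a) * z powr ((1 - a) - 1))"
      using False by (intro MVT2) (auto intro!: derivative_eq_intros)
    then obtain z where z: "real n < z" "z < real (Suc n)"
      "real (Suc n) powr (1 - a) - real n powr (1 - a) = (1 - a) * z powr - a" by auto
    moreover have "real (Suc n) powr - a \<le> z powr - a"
      using z a False by (intro powr_mono2') auto
    ultimately show ?thesis using a by (simp add: mult_left_mono)
  qed
  then have "real (Suc n) powr - a \<le> (real (Suc n) powr (1 - a) - real n powr (1 - a)) / (1 - a)"
    using a by (simp add: field_simps)
  then show ?case using Suc.IH by (simp add: diff_divide_distrib)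
qed

text \<open>The inequality \<open>ln x \<le> x - 1\<close> at \<open>x = n / (n + 1)\<close> bounds
  each new term by an increment of the logarithm.\<close>

lemma sum_inverse_le_ln:
  assumes "1 \<le> n"
  shows "(\<Sum>k=1..n. 1 / real k) \<le> 1 + ln (real n)"
  using assms
proof (induction n rule: dec_induct)
  case base
  then show ?case by simp
next
  case (step n)
  have n: "0 < real n" using step by simp
  have "ln (real n / real (Suc n)) \<le> real n / real (Suc n) - 1"
    using n by (intro ln_le_minus_one) simp
  also have "\<dots> = - (1 / real (Suc n))" by (simp add: field_simps)
  finally have "1 / real (Suc n) \<le> ln (real (Suc n)) - ln (real n)"
    using n by (simp add: ln_div)
  then show ?case using step.IH by simp
qed

text \<open>The three regimes of the theorem arise here: the sum grows like
  \<open>n powr (1 - s / 2)\<close>, grows logarithmically, or stays bounded, according as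
  \<open>s / 2\<close> is below, at or above 1.\<close>

lemma exists_sum_powr_bound:
  fixes s :: real
  assumes s: "0 \<le> s"
  obtains L where "0 \<le> L" "\<And>n. 2 \<le> n \<Longrightarrow>
    real n powr (1 - 3 * s / 2) * (\<Sum>k=1..n. real k powr - (s / 2))
      \<le> L * (if s < 2 then real n powr (2 - 2 * s)
             else if s = 2 then real n powr (-2) * ln (real n)
             else real n powr (1 - 3 * s / 2))"
proof -
  consider "s < 2" | "s = 2" | "s > 2" by linarith
  then show thesis
  proof cases
    case 1
    show ?thesis
    proof (rule that[of "1 / (1 - s / 2)"])
      fix n :: nat assume "2 \<le> n"
      have "real n powr (1 - 3 * s / 2) * (\<Sum>k=1..n. real k powr - (s / 2))
          \<le> real n powr (1 - 3 * s / 2) * (real n powr (1 - s / 2) / (1 - s / 2))"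
        using sum_powr_neg_le[of "s / 2" n] 1 s by (intro mult_left_mono) auto
      also have "\<dots> = 1 / (1 - s / 2) * real n powr (2 - 2 * s)"
        by (simp add: powr_add[symmetric])
      finally show "real n powr (1 - 3 * s / 2) * (\<Sum>k=1..n. real k powr - (s / 2))
          \<le> 1 / (1 - s / 2) * (if s < 2 then real n powr (2 - 2 * s)
             else if s = 2 then real n powr (-2) * ln (real n)
             else real n powr (1 - 3 * s / 2))" using 1 by simp
    qed (use 1 in simp)
  next
    case 2
    show ?thesis
    \<comment> \<open>Since \<open>n \<ge> 2\<close>, the summand 1 in \<open>1 + ln n\<close> is at
      most \<open>ln n / ln 2\<close>.\<close>
    proof (rule that[of "1 / ln 2 + 1"])
      fix n :: nat assume n: "2 \<le> n"
      have "(\<Sum>k=1..n. real k powr - (s / 2)) = (\<Sum>k=1..n. 1 / real k)"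
        using 2 by (intro sum.cong) (auto simp: powr_minus divide_inverse)
      also have "\<dots> \<le> 1 + ln (real n)" using sum_inverse_le_ln n by simp
      also have "\<dots> \<le> (1 / ln 2 + 1) * ln (real n)"
        using n by (simp add: distrib_right pos_le_divide_eq)
      finally have "real n powr (1 - 3 * s / 2) * (\<Sum>k=1..n. real k powr - (s / 2))
          \<le> real n powr (1 - 3 * s / 2) * ((1 / ln 2 + 1) * ln (real n))"
        by (intro mult_left_mono) auto
      then show "real n powr (1 - 3 * s / 2) * (\<Sum>k=1..n. real k powr - (s / 2))
          \<le> (1 / ln 2 + 1) * (if s < 2 then real n powr (2 - 2 * s)
             else if s = 2 then real n powr (-2) * ln (real n)
             else real n powr (1 - 3 * s / 2))" using 2 by (simp add: mult_ac)
    qed simp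
  next
    case 3
    then have sm: "summable (\<lambda>k. real k powr - (s / 2))"
      using summable_real_powr_iff[of "- (s / 2)"] by simp
    show ?thesis
    proof (rule that[of "\<Sum>k. real k powr - (s / 2)"])
      fix n :: nat
      have "(\<Sum>k=1..n. real k powr - (s / 2)) \<le> (\<Sum>k. real k powr - (s / 2))"
        by (rule sum_le_suminf[OF sm]) auto
      then have "real n powr (1 - 3 * s / 2) * (\<Sum>k=1..n. real k powr - (s / 2))
          \<le> real n powr (1 - 3 * s / 2) * (\<Sum>k. real k powr - (s / 2))"
        by (intro mult_left_mono) auto
      then show "real n powr (1 - 3 * s / 2) * (\<Sum>k=1..n. real k powr - (s / 2))
          \<le> (\<Sum>k. real k powr - (s / 2)) * (if s < 2 then real n powr (2 - 2 * s)
             else if s = 2 then real n powr (-2) * ln (real n)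
             else real n powr (1 - 3 * s / 2))" using 3 by (simp add: mult_ac)
    qed (use sm in \<open>auto intro: suminf_nonneg\<close>)
  qed
qed

section \<open>Pole separation and distinctness of great circles\<close>

lemma finite_signed_norms:
  fixes p :: "nat \<Rightarrow> 'a :: real_normed_vector"
  shows "finite {norm (a *\<^sub>R p i + b *\<^sub>R p j) | i j a b.
     i \<in> {1..n} \<and> j \<in> {1..n} \<and> i \<noteq> j \<and> a \<in> {1, -1} \<and> b \<in> {1, -1}}" (is "finite ?N")
proof (rule finite_subset)
  show "?N \<subseteq> (\<lambda>(i, j, a, b). norm (a *\<^sub>R p i + b *\<^sub>R p j)) ` ({1..n} \<times> {1..n} \<times> {1, -1} \<times> {1, -1})"
  proof
    fix x assume "x \<in> ?N"
    then obtain i j a b where "x = norm (a *\<^sub>R p i + b *\<^sub>R p j)" "i \<in> {1..n}" "j \<in> {1..n}"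
      "a \<in> {1, -1}" "b \<in> {1, -1}" by blast
    then show "x \<in> (\<lambda>(i, j, a, b). norm (a *\<^sub>R p i + b *\<^sub>R p j)) ` ({1..n} \<times> {1..n} \<times> {1, -1} \<times> {1, -1})"
      by (intro image_eqI[of _ _ "(i, j, a, b)"]; simp; blast)
  qed
qed simp

lemma pole_separation_le:
  assumes "i \<in> {1..n}" "j \<in> {1..n}" "i \<noteq> j" "a \<in> {1, -1}" "b \<in> {1, -1}"
  shows "pole_separation n p \<le> norm (a *\<^sub>R p i + b *\<^sub>R p j)"
  unfolding pole_separation_def
by (rule Min_le[OF finite_signed_norms]) (use assms in blast)

lemma pole_separation_ge:
  assumes n: "2 \<le> n"
    and "\<And>i j. i \<in> {1..n} \<Longrightarrow> j \<in> {1..n} \<Longrightarrow> i \<noteq> j \<Longrightarrow> d \<le> norm (p i - p j)"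
    and "\<And>i j. i \<in> {1..n} \<Longrightarrow> j \<in> {1..n} \<Longrightarrow> i \<noteq> j \<Longrightarrow> d \<le> norm (p i + p j)"
  shows "d \<le> pole_separation n p"
  unfolding pole_separation_def
proof (rule Min.boundedI[OF finite_signed_norms])
  \<comment> \<open>The pair 1, 2 makes the set under \<open>Min\<close> nonempty; this is where
    \<open>n \<ge> 2\<close> enters.\<close>
  have "(1::nat) \<in> {1..n} \<and> 2 \<in> {1..n} \<and> (1::nat) \<noteq> 2" using n by auto
  then show "{norm (a *\<^sub>R p i + b *\<^sub>R p j) | i j a b.
      i \<in> {1..n} \<and> j \<in> {1..n} \<and> i \<noteq> j \<and> a \<in> {1, -1} \<and> b \<in> {1, -1}} \<noteq> {}" by blast
next
  fix x assume "x \<in> {norm (a *\<^sub>R p i + b *\<^sub>R p j) | i j a b.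
      i \<in> {1..n} \<and> j \<in> {1..n} \<and> i \<noteq> j \<and> a \<in> {1, -1} \<and> b \<in> {1, -1}}"
  then obtain i j a b where x: "x = norm (a *\<^sub>R p i + b *\<^sub>R p j)" "i \<in> {1..n}" "j \<in> {1..n}" "i \<noteq> j"
    and ab: "a \<in> {1, -1}" "b \<in> {1, -1 :: real}" by blast
  have "norm (- p i + p j) = norm (p i - p j)" "norm (- p i - p j) = norm (p i + p j)"
    using norm_minus_commute[of "p j" "p i"] norm_minus_cancel[of "p i + p j"] by (simp_all add: algebra_simps)
  then show "d \<le> x" using x ab assms(2,3)[of i j] by auto
qed

text \<open>Let \<open>w\<close> be the component of \<open>q\<close> orthogonal to
  \<open>p\<close>. If it were nonzero, its normalisation would lie on both circles, so
  \<open>w\<close> would be orthogonal to \<open>p\<close> and \<open>q\<close>, hence to itself.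
  Thus \<open>q\<close> is a multiple of \<open>p\<close>.\<close>

lemma great_circle_eqD:
  assumes p: "p \<in> S2" and q: "q \<in> S2" and eq: "great_circle p = great_circle q"
  shows "q = p \<or> q = - p"
proof -
  define w where "w = q - (q \<bullet> p) *\<^sub>R p"
  have n: "p \<bullet> p = 1" "q \<bullet> q = 1" using p q by (simp_all add: norm_eq_1)
  have wp: "w \<bullet> p = 0" by (simp add: w_def inner_diff_left n)
  have "w = 0"
  proof (rule ccontr)
    assume w: "w \<noteq> 0"
    then have "sgn w \<in> great_circle p"
      using wp by (simp add: great_circle_def norm_sgn sgn_div_norm)
    then have "sgn w \<in> great_circle q" using eq by simp
    then have "sgn w \<bullet> q = 0" by (simp add: great_circle_def)
    then have "w \<bullet> q = 0" using w by (simp add: sgn_div_norm)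
    then have "w \<bullet> w = 0" using wp by (subst (2) w_def) (simp add: inner_diff_right)
    then show False using w by simp
  qed
  then have qp: "q = (q \<bullet> p) *\<^sub>R p" by (simp add: w_def)
  then have "norm q = \<bar>q \<bullet> p\<bar> * norm p" by (metis norm_scaleR)
  then have "\<bar>q \<bullet> p\<bar> = 1" using p q by simp
  then show ?thesis using qp by (metis abs_eq_iff' scaleR_minus1_left scaleR_one abs_1 abs_eq_iff)
qed

section \<open>Counting separated points of the sphere near a given point\<close>

lemma card_sphere_packing_le:
  fixes q :: "'i \<Rightarrow> real ^ 3"
  assumes J: "finite J" and d: "0 < d" "d \<le> R" and R: "R \<le> 2"
    and q: "\<And>j. j \<in> J \<Longrightarrow> q j \<in> S2"
    and sep: "\<And>i j. i \<in> J \<Longrightarrow> j \<in> J \<Longrightarrow> i \<noteq> j \<Longrightarrow> d \<le> dist (q i) (q j)"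
    and near: "\<And>j. j \<in> J \<Longrightarrow> dist p (q j) \<le> R"
  shows "real (card J) * d\<^sup>2 \<le> 4096 * R\<^sup>2"
proof -
  \<comment> \<open>Scaling the \<open>q j\<close> inwards in about \<open>R / d\<close> steps turns the two-dimensional count into
    a packing of Euclidean balls, so that no area of spherical caps is needed.\<close>
  define M where "M = Suc (nat \<lfloor>R / d\<rfloor>)"
  define I where "I = J \<times> {..<M}"
  define t where "t k = 1 - real k * d / 4" for k
  define x where "x = (\<lambda>(j, k). t k *\<^sub>R q j)"
  \<comment> \<open>The \<open>Suc\<close> in \<open>M\<close> serves both sides: every index
    \<open>k < M\<close> is still at most \<open>R / d\<close>, and \<open>M\<close> itself is at
    least \<open>R / d\<close>.\<close>
  have kd: "real k * d \<le> R" if "k < M" for k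
  proof -
    have "real k \<le> real (nat \<lfloor>R / d\<rfloor>)" using that unfolding M_def by simp
    also have "\<dots> \<le> R / d" using d by (intro of_nat_floor) simp
    finally have "real k \<le> R / d" .
    then show ?thesis using d by (simp add: field_simps)
  qed
  have t: "1/2 \<le> t k" if "k < M" for k using kd[OF that] R unfolding t_def by linarith
  have nx: "norm (x (j, k)) = t k" if "j \<in> J" "k < M" for j k
    using q[OF that(1)] kd[OF that(2)] R by (simp add: x_def t_def)
  have "real (card I) * (d / 8) ^ DIM(real ^ 3) \<le> (2 * R) ^ DIM(real ^ 3)"
  proof (rule card_ball_packing_le)
    show "finite I" using J by (simp add: I_def)
    show "0 < d / 8" "0 \<le> 2 * R" using d by auto
    show "2 * (d / 8) \<le> dist (x u) (x v)" if uv: "u \<in> I" "v \<in> I" "u \<noteq> v" for u v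
    proof -
      obtain i k j l where u: "u = (i, k)" "i \<in> J" "k < M" and v: "v = (j, l)" "j \<in> J" "l < M"
        using uv by (auto simp: I_def)
      show ?thesis
      \<comment> \<open>Within one layer distances shrink by \<open>t k\<close>, which is at least
        \<open>1/2\<close> because \<open>R \<le> 2\<close>; points of different layers have norms
        differing by at least \<open>d / 4\<close>.\<close>
      proof (cases "k = l")
        case True
        have "d / 4 \<le> 1 / 2 * d" using d by simp
        also have "\<dots> \<le> t k * dist (q i) (q j)"
          using sep[of i j] u v uv(3) True t[OF u(3)] d by (intro mult_mono) auto
        also have "\<dots> = dist (x u) (x v)"
          using True u(1) v(1) t[OF u(3)]
          by (simp add: x_def dist_norm flip: scaleR_diff_right)
        finally show ?thesis by simp
      next
        case False
        then have "1 \<le> \<bar>real k - real l\<bar>" by linarith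
        then have "1 * (d / 4) \<le> \<bar>real k - real l\<bar> * (d / 4)"
          using d by (intro mult_right_mono) auto
        also have "\<dots> = \<bar>(real k - real l) * (d / 4)\<bar>" using d by (simp add: abs_mult)
        also have "\<dots> = \<bar>norm (x u) - norm (x v)\<bar>"
        proof -
          have "(real k - real l) * (d / 4) = t l - t k" by (simp add: t_def algebra_simps diff_divide_distrib)
          then show ?thesis
            unfolding u(1) v(1) nx[OF u(2,3)] nx[OF v(2,3)] by (simp only: abs_minus_commute)
        qed
        also have "\<dots> \<le> dist (x u) (x v)" unfolding dist_norm by (rule norm_triangle_ineq3)
        finally show ?thesis by simp
      qed
    qed
    show "ball (x u) (d / 8) \<subseteq> ball p (2 * R)" if uI: "u \<in> I" for u
    proof -
      obtain i k where u: "u = (i, k)" "i \<in> J" "k < M" using uI by (auto simp: I_def)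
      have "q i - x u = (real k * d / 4) *\<^sub>R q i"
        by (simp add: u x_def t_def algebra_simps)
      then have "dist (q i) (x u) = real k * d / 4"
        using q[OF u(2)] d unfolding dist_norm by simp
      then have "dist p (x u) \<le> R + R / 4"
        using dist_triangle[of p "x u" "q i"] near[OF u(2)] kd[OF u(3)] by linarith
      then show ?thesis
      proof (intro subsetI)
        fix y assume "y \<in> ball (x u) (d / 8)"
        then have "dist p y < dist p (x u) + d / 8"
          using dist_triangle[of p y "x u"] by simp
        then show "y \<in> ball p (2 * R)" using \<open>dist p (x u) \<le> R + R / 4\<close> d by simp
      qed
    qed
  qed
  \<comment> \<open>The constant is \<open>(2 * 8) ^ 3\<close>, from balls of radius
    \<open>d / 8\<close> inside one of radius \<open>2 * R\<close>. Replacing \<open>M\<close> by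
    \<open>R / d\<close> then lowers both exponents from 3 to 2.\<close>
  then have 1: "real (card J) * real M * d ^ 3 \<le> 4096 * R ^ 3"
    by (simp add: I_def card_cartesian_product power_divide power_mult_distrib)
  have "R / d \<le> real M" using d unfolding M_def by linarith
  then have "real (card J) * (R / d) * d ^ 3 \<le> real (card J) * real M * d ^ 3"
    using d by (intro mult_right_mono mult_left_mono) auto
  also note 1
  also have "real (card J) * (R / d) * d ^ 3 = R * (real (card J) * d\<^sup>2)"
    using d by (simp add: power2_eq_square power3_eq_cube)
  also have "4096 * R ^ 3 = R * (4096 * R\<^sup>2)"
    by (simp add: power2_eq_square power3_eq_cube)
  finally show ?thesis using d by simp
qed

section \<open>The upper bound for the sum of overlaps\<close>

text \<open>The reciprocal distances \<open>1 / d j\<close> satisfy the counting hypothesis of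
  \<open>sum_powr_le_of_card_le\<close> with \<open>B = 4096 * n / c^2\<close>, by packing. The
  overlap bound contributes \<open>n powr (- 2 * s)\<close> and \<open>B\<close> contributes
  \<open>n powr (s / 2)\<close>.\<close>

lemma sum_overlap_powr_le:
  assumes c: "0 < c" and s: "0 \<le> s" and n: "2 \<le> n" and i: "i \<in> {1..n}"
    and p: "\<And>i. i \<in> {1..n} \<Longrightarrow> p i \<in> S2" and sep: "c / sqrt (real n) \<le> pole_separation n p"
  shows "(\<Sum>j\<in>{1..n} - {i}. overlap n p i j powr s)
    \<le> 48 powr s * (4096 / c\<^sup>2) powr (s / 2) *
        (real n powr (- 3 * s / 2) * (\<Sum>k=1..n. real k powr - (s / 2)))"
proof -
  define J where "J = {1..n} - {i}"
  define \<delta> where "\<delta> = c / sqrt (real n)"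
  define d where "d j = min (norm (p i - p j)) (norm (p i + p j))" for j
  define B where "B = 4096 / \<delta>\<^sup>2"
  have B0: "0 \<le> B" by (simp add: B_def)
  have J: "finite J" "card J = n - 1" using i by (simp_all add: J_def)
  have \<delta>: "0 < \<delta>" using c n by (simp add: \<delta>_def)
  have signed: "\<delta> \<le> norm (a *\<^sub>R p j + b *\<^sub>R p k)"
    if "j \<in> {1..n}" "k \<in> {1..n}" "j \<noteq> k" "a \<in> {1, -1}" "b \<in> {1, -1}" for j k a b
    using sep pole_separation_le[OF that, of p] by (simp add: \<delta>_def)
  have d: "\<delta> \<le> d j" if "j \<in> J" for j
    using signed[of i j 1 1] signed[of i j 1 "-1"] that i by (simp add: d_def J_def)
  have d2: "d j \<le> 2" if "j \<in> J" for j
    using norm_triangle_ineq[of "p i" "p j"] p[OF i] p[of j] that by (auto simp: d_def J_def)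
  have "(\<Sum>j\<in>J. (1 / d j) powr s) \<le> (\<Sum>k=1..card J. (B / real k) powr (s / 2))"
  proof (rule sum_powr_le_of_card_le[OF J(1) s])
    fix j assume j: "j \<in> J"
    then have dj: "0 < d j" using d[OF j] \<delta> by linarith
    then show "0 \<le> 1 / d j" by simp
    define A where "A = {k \<in> J. 1 / d j \<le> 1 / d k}"
    \<comment> \<open>The sign selects whichever of the poles \<open>p k\<close>,
      \<open>- p k\<close> is nearer to \<open>p i\<close>. The chosen poles remain
      \<open>\<delta>\<close>-separated because the separation covers all signs.\<close>
    define e where "e k = (if norm (p i - p k) \<le> norm (p i + p k) then 1 else - 1 :: real)" for k
    have e: "e k \<in> {1, -1}" for k by (simp add: e_def)
    have de: "dist (p i) (e k *\<^sub>R p k) = d k" for k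
      by (simp add: e_def d_def dist_norm)
    have "real (card A) * \<delta>\<^sup>2 \<le> 4096 * (d j)\<^sup>2"
    proof (rule card_sphere_packing_le[where q = "\<lambda>k. e k *\<^sub>R p k" and p = "p i"])
      show "finite A" using J by (simp add: A_def)
      show "e k *\<^sub>R p k \<in> S2" if "k \<in> A" for k
        using that p e[of k] by (auto simp: A_def J_def)
      show "\<delta> \<le> dist (e k *\<^sub>R p k) (e l *\<^sub>R p l)" if "k \<in> A" "l \<in> A" "k \<noteq> l" for k l
        using that e[of k] e[of l] signed[of k l "e k" "- e l"]
        by (auto simp: A_def J_def dist_norm)
      show "dist (p i) (e k *\<^sub>R p k) \<le> d j" if "k \<in> A" for k
      proof -
        have "0 < d k" "1 / d j \<le> 1 / d k" using that d[of k] \<delta> by (auto simp: A_def)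
        then show ?thesis unfolding de using dj by (simp add: field_simps)
      qed
    qed (use \<delta> d[OF j] d2[OF j] in auto)
    then show "real (card {k \<in> J. 1 / d j \<le> 1 / d k}) * (1 / d j)\<^sup>2 \<le> B"
      using dj \<delta> by (simp add: A_def B_def field_simps)
  qed
  also have "\<dots> \<le> (\<Sum>k=1..n. (B / real k) powr (s / 2))"
    by (rule sum_mono2) (auto simp: J)
  also have "\<dots> = B powr (s / 2) * (\<Sum>k=1..n. real k powr - (s / 2))"
    unfolding sum_distrib_left
    by (intro sum.cong) (simp_all add: powr_divide powr_minus_divide B0)
  finally have 1: "(\<Sum>j\<in>J. (1 / d j) powr s) \<le> B powr (s / 2) * (\<Sum>k=1..n. real k powr - (s / 2))" .
  have B: "B = 4096 / c\<^sup>2 * real n"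
    using n by (simp add: B_def \<delta>_def power_divide)
  have "(\<Sum>j\<in>J. overlap n p i j powr s) \<le> (\<Sum>j\<in>J. (48 / (real n)\<^sup>2) powr s * (1 / d j) powr s)"
  proof (rule sum_mono)
    fix j assume j: "j \<in> J"
    then have dj: "0 < d j" using d[OF j] \<delta> by linarith
    have "overlap n p i j \<le> 48 / (real n)\<^sup>2 * (1 / d j)"
      using overlap_le[of p i j n] p i j dj by (simp add: d_def J_def)
    then have "overlap n p i j powr s \<le> (48 / (real n)\<^sup>2 * (1 / d j)) powr s"
      by (intro powr_mono2 s overlap_nonneg)
    also have "\<dots> = (48 / (real n)\<^sup>2) powr s * (1 / d j) powr s"
      by (rule powr_mult)
    finally show "overlap n p i j powr s \<le> (48 / (real n)\<^sup>2) powr s * (1 / d j) powr s" .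
  qed
  also have "\<dots> \<le> (48 / (real n)\<^sup>2) powr s * (B powr (s / 2) * (\<Sum>k=1..n. real k powr - (s / 2)))"
    using 1 unfolding sum_distrib_left[symmetric] by (intro mult_left_mono) auto
  also have "(48 / (real n)\<^sup>2) powr s = 48 powr s * real n powr (- 2 * s)"
  proof -
    have "(real n)\<^sup>2 = real n powr 2" using n by simp
    then show ?thesis using n by (simp only: powr_divide powr_powr) (simp add: powr_minus_divide)
  qed
  also have "B powr (s / 2) = (4096 / c\<^sup>2) powr (s / 2) * real n powr (s / 2)"
    unfolding B by (rule powr_mult)
  also have "48 powr s * real n powr (- 2 * s) * ((4096 / c\<^sup>2) powr (s / 2) * real n powr (s / 2)
        * (\<Sum>k=1..n. real k powr - (s / 2)))
      = 48 powr s * (4096 / c\<^sup>2) powr (s / 2) * ((real n powr (- 2 * s) * real n powr (s / 2))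
        * (\<Sum>k=1..n. real k powr - (s / 2)))"
    by (simp only: mult_ac)
  also have "real n powr (- 2 * s) * real n powr (s / 2) = real n powr (- 3 * s / 2)"
    by (simp add: powr_add[symmetric])
  finally show ?thesis unfolding J_def .
qed

text \<open>Summing the bound for a fixed \<open>i\<close> over all \<open>n\<close> circles adds 1
  to the exponent \<open>- 3 * s / 2\<close>. The constant is \<open>C * L\<close>, with
  \<open>C\<close> depending on \<open>s\<close> and \<open>c\<close> and \<open>L\<close> on
  \<open>s\<close> alone.\<close>

lemma exists_sum_overlap_bound:
  fixes s c :: real
  assumes s: "0 \<le> s" and c: "0 < c"
  shows "\<exists>K. \<forall>n\<ge>2. \<forall>p. (\<forall>i\<in>{1..n}. p i \<in> S2) \<and> pole_separation n p \<ge> c / sqrt (real n) \<longrightarrow>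
    (\<Sum>(i, j) \<in> {(i, j). i \<in> {1..n} \<and> j \<in> {1..n} \<and> i \<noteq> j}. overlap n p i j powr s)
      \<le> K * (if s < 2 then real n powr (2 - 2 * s)
             else if s = 2 then real n powr (-2) * ln (real n)
             else real n powr (1 - 3 * s / 2))"
proof -
  obtain L where L: "\<And>n. 2 \<le> n \<Longrightarrow>
    real n powr (1 - 3 * s / 2) * (\<Sum>k=1..n. real k powr - (s / 2))
      \<le> L * (if s < 2 then real n powr (2 - 2 * s)
             else if s = 2 then real n powr (-2) * ln (real n)
             else real n powr (1 - 3 * s / 2))" (is "\<And>n. _ \<Longrightarrow> _ \<le> L * ?G n")
    using exists_sum_powr_bound[OF s] by blast
  define C where "C = 48 powr s * (4096 / c\<^sup>2) powr (s / 2)"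
  show ?thesis
  proof (intro exI[of _ "C * L"] allI impI, elim conjE)
    fix n :: nat and p :: "nat \<Rightarrow> real ^ 3"
    assume n: "2 \<le> n" and p: "\<forall>i\<in>{1..n}. p i \<in> S2"
      and sep: "c / sqrt (real n) \<le> pole_separation n p"
    have "{(i, j). i \<in> {1..n} \<and> j \<in> {1..n} \<and> i \<noteq> j} = (SIGMA i:{1..n}. {1..n} - {i})" by auto
    then have "(\<Sum>(i, j) \<in> {(i, j). i \<in> {1..n} \<and> j \<in> {1..n} \<and> i \<noteq> j}. overlap n p i j powr s)
        = (\<Sum>i\<in>{1..n}. \<Sum>j\<in>{1..n} - {i}. overlap n p i j powr s)"
      by (simp add: sum.Sigma)
    also have "\<dots> \<le> (\<Sum>i\<in>{1..n}. C * (real n powr (- 3 * s / 2) * (\<Sum>k=1..n. real k powr - (s / 2))))"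
      unfolding C_def using p sep by (intro sum_mono sum_overlap_powr_le c s n) auto
    also have "\<dots> = C * ((real n powr 1 * real n powr (- 3 * s / 2)) * (\<Sum>k=1..n. real k powr - (s / 2)))"
      using n by simp
    also have "real n powr 1 * real n powr (- 3 * s / 2) = real n powr (1 - 3 * s / 2)"
      unfolding powr_add[symmetric] by simp
    also have "C * (real n powr (1 - 3 * s / 2) * (\<Sum>k=1..n. real k powr - (s / 2))) \<le> C * (L * ?G n)"
      by (intro mult_left_mono L n) (simp add: C_def)
    finally show "(\<Sum>(i, j) \<in> {(i, j). i \<in> {1..n} \<and> j \<in> {1..n} \<and> i \<noteq> j}. overlap n p i j powr s)
        \<le> C * L * ?G n" by (simp only: mult.assoc)
  qed
qed

section \<open>Separated configurations and the final assembly\<close>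

text \<open>Grid points of \<open>[0, 1/2]^2\<close> with spacing \<open>h\<close> are lifted to the
  sphere. Two lifts differ by at least \<open>h\<close> in a horizontal coordinate, and all heights
  are at least \<open>1/2\<close>, so no lift comes near the antipode of another.\<close>

lemma exists_separated_poles:
  assumes n: "2 \<le> n"
  shows "\<exists>p :: nat \<Rightarrow> real ^ 3. (\<forall>i\<in>{1..n}. p i \<in> S2) \<and> pole_separation n p \<ge> (1/4) / sqrt (real n)"
proof -
  \<comment> \<open>The grid has \<open>m * m \<ge> n\<close> points, and
    \<open>m \<le> 2 * sqrt n\<close> makes the spacing at least \<open>(1/4) / sqrt n\<close>.
    Since indices start at 1, the grid position is read off from \<open>i - 1\<close> in base
    \<open>m\<close>.\<close>
  define m where "m = nat \<lceil>sqrt (real n)\<rceil>"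
  define h where "h = 1 / (2 * real m)"
  define x where "x i = real ((i - 1) div m) * h" for i
  define y where "y i = real ((i - 1) mod m) * h" for i
  define z where "z i = sqrt (1 - (x i)\<^sup>2 - (y i)\<^sup>2)" for i
  define p :: "nat \<Rightarrow> real ^ 3" where "p i = vector [x i, y i, z i]" for i
  have s1: "1 \<le> sqrt (real n)" using n by simp
  have m: "sqrt (real n) \<le> real m" "real m \<le> sqrt (real n) + 1"
    using s1 unfolding m_def by linarith+
  have "1 \<le> real m" using m(1) s1 by linarith
  then have m0: "0 < m" by simp
  have "real n = (sqrt (real n))\<^sup>2" by simp
  also have "\<dots> \<le> (real m)\<^sup>2" using m by (intro power_mono) auto
  finally have nm: "n \<le> m * m" by (simp add: power2_eq_square flip: of_nat_mult)
  have h: "0 < h" using m0 by (simp add: h_def)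
  have hn: "(1/4) / sqrt (real n) \<le> h"
    using frac_le[of 1 1 "2 * real m" "4 * sqrt (real n)"] m s1 m0 by (simp add: h_def)
  have half: "real k * h \<le> 1 / 2" if "k < m" for k
    using that m0 by (simp add: h_def field_simps)
  have xy: "0 \<le> x i" "x i \<le> 1/2" "0 \<le> y i" "y i \<le> 1/2" if "i \<in> {1..n}" for i
  proof -
    have "i - 1 < m * m" using that nm by auto
    then have "(i - 1) div m < m" by (rule less_mult_imp_div_less)
    then show "x i \<le> 1/2" unfolding x_def by (rule half)
    show "y i \<le> 1/2" unfolding y_def using m0 by (intro half) simp
  qed (use h in \<open>auto simp: x_def y_def\<close>)
  have z: "1/2 \<le> z i" "(z i)\<^sup>2 = 1 - (x i)\<^sup>2 - (y i)\<^sup>2" if "i \<in> {1..n}" for i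
  proof -
    have "(x i)\<^sup>2 \<le> (1/2)\<^sup>2" "(y i)\<^sup>2 \<le> (1/2)\<^sup>2"
      by (intro power_mono xy[OF that])+
    moreover have quarter: "(1/2 :: real)\<^sup>2 = 1/4" by (simp add: power2_eq_square)
    ultimately have le: "(1/2)\<^sup>2 \<le> 1 - (x i)\<^sup>2 - (y i)\<^sup>2" by linarith
    then show "1/2 \<le> z i" unfolding z_def by (rule real_le_rsqrt)
    have "0 \<le> 1 - (x i)\<^sup>2 - (y i)\<^sup>2" using le quarter by linarith
    then show "(z i)\<^sup>2 = 1 - (x i)\<^sup>2 - (y i)\<^sup>2" by (simp add: z_def)
  qed
  have comp: "p i $ 1 = x i" "p i $ 2 = y i" "p i $ 3 = z i" for i
    by (simp_all add: p_def)
  have "p i \<in> S2" if "i \<in> {1..n}" for i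
    using z(2)[OF that] by (simp add: norm_eq_1 inner_vec_def sum_3 comp power2_eq_square)
  moreover have "(1/4) / sqrt (real n) \<le> pole_separation n p"
  proof (rule pole_separation_ge[OF n])
    fix i j assume ij: "i \<in> {1..n}" "j \<in> {1..n}" "i \<noteq> j"
    have grid: "h \<le> \<bar>real k * h - real l * h\<bar>" if "k \<noteq> l" for k l :: nat
    proof -
      have "1 * h \<le> \<bar>real k - real l\<bar> * h" using that h by (intro mult_right_mono) linarith+
      then show ?thesis using h by (simp add: abs_mult flip: left_diff_distrib)
    qed
    have "h \<le> norm (p i - p j)"
    \<comment> \<open>Distinct indices differ in the quotient or in the remainder, that is, in the
      first or the second coordinate.\<close>
    proof (cases "(i - 1) div m = (j - 1) div m")
      case True
      have "i - 1 \<noteq> j - 1" using ij by auto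
      then have "(i - 1) mod m \<noteq> (j - 1) mod m" using True by (metis div_mult_mod_eq)
      then have "h \<le> \<bar>(p i - p j) $ 2\<bar>" using grid by (simp add: comp y_def)
      then show ?thesis using component_le_norm_cart[of "p i - p j" 2] by linarith
    next
      case False
      then have "h \<le> \<bar>(p i - p j) $ 1\<bar>" using grid by (simp add: comp x_def)
      then show ?thesis using component_le_norm_cart[of "p i - p j" 1] by linarith
    qed
    then show "(1/4) / sqrt (real n) \<le> norm (p i - p j)" using hn by linarith
    have "1 \<le> \<bar>(p i + p j) $ 3\<bar>" using z(1)[OF ij(1)] z(1)[OF ij(2)] by (simp add: comp)
    then have "1 \<le> norm (p i + p j)" using component_le_norm_cart[of "p i + p j" 3] by linarith
    moreover have "(1/4) / sqrt (real n) \<le> 1"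
      using frac_le[of 1 1 1 "4 * sqrt (real n)"] s1 by simp
    ultimately show "(1/4) / sqrt (real n) \<le> norm (p i + p j)" by linarith
  qed
  ultimately show ?thesis by blast
qed

text \<open>Circles coincide only for equal or antipodal poles, and either case would make one of
  the signed norms zero. This guarantees genuinely distinct circles in the last claim of the
  theorem.\<close>

lemma inj_on_great_circle:
  assumes p: "\<forall>i\<in>{1..n}. p i \<in> S2" and sep: "0 < pole_separation n p"
  shows "inj_on (\<lambda>i. great_circle (p i)) {1..n}"
proof (rule inj_onI, rule ccontr)
  fix i j assume ij: "i \<in> {1..n}" "j \<in> {1..n}" "great_circle (p i) = great_circle (p j)" "i \<noteq> j"
  then have "p j = p i \<or> p j = - p i" using p by (intro great_circle_eqD) auto
  moreover have "0 < norm (1 *\<^sub>R p i + b *\<^sub>R p j)" if "b \<in> {1, -1}" for b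
    by (rule less_le_trans[OF sep pole_separation_le]) (use ij that in auto)
  from this[of 1] this[of "-1"] have "p i + p j \<noteq> 0" "p i - p j \<noteq> 0" by auto
  ultimately show False by auto
qed

theorem mainTheorem2:
  shows "(\<forall>s c :: real. s \<ge> 0 \<and> c > 0 \<longrightarrow>
           (\<exists>K :: real. \<forall>n :: nat. n \<ge> 2 \<longrightarrow>
             (\<forall>p :: nat \<Rightarrow> real ^ 3.
               (\<forall>i\<in>{1..n}. p i \<in> S2) \<and> pole_separation n p \<ge> c / sqrt (real n) \<longrightarrow>
               (\<Sum>(i, j) \<in> {(i, j). i \<in> {1..n} \<and> j \<in> {1..n} \<and> i \<noteq> j}. overlap n p i j powr s)
                 \<le> K * (if s < 2 then real n powr (2 - 2 * s)
                        else if s = 2 then real n powr (-2) * ln (real n)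
                        else real n powr (1 - 3 * s / 2)))))
       \<and> (\<exists>c\<^sub>0 :: real. c\<^sub>0 > 0 \<and>
           (\<forall>n :: nat. n \<ge> 2 \<longrightarrow>
             (\<exists>p :: nat \<Rightarrow> real ^ 3.
               (\<forall>i\<in>{1..n}. p i \<in> S2) \<and> pole_separation n p \<ge> c\<^sub>0 / sqrt (real n))))
       \<and> (\<exists>K :: real. \<forall>n :: nat. n \<ge> 1 \<longrightarrow>
           (\<exists>p :: nat \<Rightarrow> real ^ 3.
             (\<forall>i\<in>{1..n}. p i \<in> S2) \<and> inj_on (\<lambda>i. great_circle (p i)) {1..n} \<and>
             (\<Sum>(i, j) \<in> {(i, j). i \<in> {1..n} \<and> j \<in> {1..n} \<and> i \<noteq> j}. overlap n p i j) \<le> K))"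
    (is "?bound \<and> ?exist \<and> ?circles")
proof (intro conjI)
  show ?bound using exists_sum_overlap_bound by blast
  show ?exist
    using exists_separated_poles by (intro exI[of _ "1/4"]) auto
  show ?circles
  proof -
    \<comment> \<open>For \<open>s = 1\<close> the first regime applies with exponent
      \<open>2 - 2 * s = 0\<close>, and \<open>overlap\<close> being nonnegative removes the power
      1.\<close>
    obtain K where K: "\<And>n p. 2 \<le> n \<Longrightarrow> (\<forall>i\<in>{1..n}. p i \<in> S2) \<Longrightarrow>
        (1/4) / sqrt (real n) \<le> pole_separation n p \<Longrightarrow>
        (\<Sum>(i, j) \<in> {(i, j). i \<in> {1..n} \<and> j \<in> {1..n} \<and> i \<noteq> j}. overlap n p i j) \<le> K * real n powr 0"
      using exists_sum_overlap_bound[of 1 "1/4"] by (auto simp: overlap_nonneg)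
    show ?thesis
    \<comment> \<open>The maximum with 0 covers \<open>n = 1\<close>, where the sum is empty and
      \<open>pole_separation\<close> would be a \<open>Min\<close> over the empty set.\<close>
    proof (intro exI[of _ "max K 0"] allI impI)
      fix n :: nat assume n: "1 \<le> n"
      show "\<exists>p. (\<forall>i\<in>{1..n}. p i \<in> S2) \<and> inj_on (\<lambda>i. great_circle (p i)) {1..n} \<and>
        (\<Sum>(i, j) \<in> {(i, j). i \<in> {1..n} \<and> j \<in> {1..n} \<and> i \<noteq> j}. overlap n p i j) \<le> max K 0"
      proof (cases "n = 1")
        case True
        obtain e :: "real ^ 3" where "norm e = 1" using vector_choose_size[of 1] by auto
        moreover have none: "{(i, j). i \<in> {1..n} \<and> j \<in> {1..n} \<and> i \<noteq> j} = {}" using True by auto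
        ultimately show ?thesis using True unfolding none by (intro exI[of _ "\<lambda>_. e"]) auto
      next
        case False
        then have n2: "2 \<le> n" using n by simp
        then obtain p :: "nat \<Rightarrow> real ^ 3" where p: "\<forall>i\<in>{1..n}. p i \<in> S2"
          and sep: "(1/4) / sqrt (real n) \<le> pole_separation n p"
          using exists_separated_poles by blast
        have "0 < (1/4) / sqrt (real n)" using n2 by simp
        then have "inj_on (\<lambda>i. great_circle (p i)) {1..n}"
          using sep by (intro inj_on_great_circle p) linarith
        moreover have "(\<Sum>(i, j) \<in> {(i, j). i \<in> {1..n} \<and> j \<in> {1..n} \<and> i \<noteq> j}. overlap n p i j) \<le> max K 0"
          using K[OF n2 p sep] n2 by simp
        ultimately show ?thesis using p by blast
      qed
    qed
  qed
qed

end
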